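(* Let $(X,\epsilon,\eta,\delta,\mu)$ be a Frobenius object in $\mathbf{Rel}$, with source and target maps $s,t:X\to\eta$. Set $X_0:=\eta\subseteq X$, $X_1:=X$, $X_2:=\mu\subseteq X^3$. Let $s_0^0:X_0\to X_1$ be the inclusion, $d_0^1=s$, $d_1^1=t: X_1\to X_0$, let $s_0^1,s_1^1:X_1\to X_2$ be $s_0^1(x)=(t(x),x,x)$, $s_1^1(x)=(x,s(x),x)$, and let $d_0^2,d_1^2,d_2^2:X_2\to X_1$ be $d_0^2(x,y,z)=y$, $d_1^2(x,y,z)=z$, $d_2^2(x,y,z)=x$. Then $X_0,X_1,X_2$ with these face and degeneracy maps form a $2$-truncated simplicial set. Consequently, there exists a unique $2$-coskeletal simplicial set $\mathcal{X}$ extending it.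
   Context: In the category $\mathbf{Rel}$, objects are sets, a morphism $S:X\dashrightarrow Y$ is a subset $S\subseteq X\times Y$, composition is $T\circ S=\{(x,z)\mid \exists y:\ (x,y)\in S,\ (y,z)\in T\}$, the identity $\mathbf{1}$ is the diagonal, and $S\times T$ denotes the product relation (with $\{\bullet\}\times X\cong X\cong X\times\{\bullet\}$ identified). A Frobenius object in $\mathbf{Rel}$ is a set $X$ with morphisms $\epsilon:X\dashrightarrow\{\bullet\}$, $\eta:\{\bullet\}\dashrightarrow X$, $\delta:X\dashrightarrow X\times X$, $\mu:X\times X\dashrightarrow X$ such that (U) $\mu\circ(\eta\times\mathbf 1)=\mathbf 1=\mu\circ(\mathbf 1\times\eta)$; (C) $(\epsilon\times\mathbf 1)\circ\delta=\mathbf 1=(\mathbf 1\times\epsilon)\circ\delta$; (F) $(\mathbf 1\times\mu)\circ(\delta\times\mathbf 1)=\delta\circ\mu=(\mu\times\mathbf 1)\circ(\mathbf 1\times\delta)$. We view $\epsilon,\eta\subseteq X$ and $\delta,\mu\subseteq X^3$; $(x,y,z)\in\mu$ has inputs $x,y$ and output $z$; $(x,y,z)\in\delta$ has input $x$ and outputs $y,z$. Source and target maps: for each $x\in X$, $s(x)$ is the unique element of $\eta$ with $(x,s(x),x)\in\mu$, and $t(x)$ is the unique element of $\eta$ with $(t(x),x,x)\in\mu$. A simplicial set is a sequence of sets $X_0,X_1,\dots$ with face maps $d_i^q:X_q\to X_{q-1}$ and degeneracy maps $s_i^q:X_q\to X_{q+1}$, $0\le i\le q$, satisfying $d_i^{q-1}d_j^q=d_{j-1}^{q-1}d_i^q$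 for $i<j$; $s_i^{q+1}s_j^q=s_{j+1}^{q+1}s_i^q$ for $i\le j$; and $d_i^{q+1}s_j^q=s_{j-1}^{q-1}d_i^q$ if $i<j$, $=\mathrm{id}$ if $i=j$ or $j+1$, $=s_j^{q-1}d_{i-1}^q$ if $i>j+1$. An $n$-truncated simplicial set has only $X_0,\dots,X_n$ and the maps between them, satisfying those identities for which both sides exist. For $q\ge1$, $\Delta_q\mathcal X$ is the set of tuples $(\zeta_0,\dots,\zeta_q)$ in $X_{q-1}$ with $d_i^{q-1}\zeta_j=d_{j-1}^{q-1}\zeta_i$ for $i<j$, and $\delta_q:X_q\to\Delta_q\mathcal X$ is $\delta_q(w)=(d_0^qw,\dots,d_q^qw)$. $\mathcal X$ is $n$-coskeletal if $\delta_q$ is a bijection for all $q>n$. Uniqueness of the coskeletal extension is understood up to the canonical isomorphism (the extension being constructed recursively by $X_{q}=\Delta_{q}\mathcal X$ for $q>n$). *)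

theory Defs
  imports "HOL-Library.FuncSet"
begin

section \<open>Frobenius objects in the category of relations\<close>

text \<open>
  A morphism from \<open>X\<close> to \<open>Y\<close> is a relation contained in \<open>X \<times> Y\<close>. The composite of \<open>S\<close> followed
  by \<open>T\<close> is the library's \<open>S O T\<close>, so composites below read in diagrammatic order, and the
  identity of \<open>X\<close> is \<open>Id_on X\<close>. The one-point set is \<open>UNIV :: unit set\<close>.
\<close>

definition rel_prod :: "('a \<times> 'b) set \<Rightarrow> ('c \<times> 'd) set \<Rightarrow> (('a \<times> 'c) \<times> ('b \<times> 'd)) set" where
  "rel_prod S T = {((x, x'), (y, y')) | x x' y y'. (x, y) \<in> S \<and> (x', y') \<in> T}"

text \<open>
  The identifications of \<open>X\<close> with \<open>1 \<times> X\<close> and \<open>X \<times> 1\<close>, and of \<open>(X \<times> X) \<times> X\<close> with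
  \<open>X \<times> (X \<times> X)\<close>, as isomorphisms of relations.
\<close>

definition lunit :: "'a set \<Rightarrow> ((unit \<times> 'a) \<times> 'a) set" where
  "lunit X = {(((), x), x) | x. x \<in> X}"

definition runit :: "'a set \<Rightarrow> (('a \<times> unit) \<times> 'a) set" where
  "runit X = {((x, ()), x) | x. x \<in> X}"

definition assoc :: "'a set \<Rightarrow> ((('a \<times> 'a) \<times> 'a) \<times> ('a \<times> ('a \<times> 'a))) set" where
  "assoc X = {(((x, y), z), (x, (y, z))) | x y z. x \<in> X \<and> y \<in> X \<and> z \<in> X}"

definition frobenius_object ::
  "'a set \<Rightarrow> ('a \<times> unit) set \<Rightarrow> (unit \<times> 'a) set \<Rightarrow> ('a \<times> ('a \<times> 'a)) set \<Rightarrow> (('a \<times> 'a) \<times> 'a) set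
    \<Rightarrow> bool" where
  "frobenius_object X \<epsilon> \<eta> \<delta> \<mu> \<longleftrightarrow>
     \<epsilon> \<subseteq> X \<times> UNIV \<and> \<eta> \<subseteq> UNIV \<times> X \<and> \<delta> \<subseteq> X \<times> (X \<times> X) \<and> \<mu> \<subseteq> (X \<times> X) \<times> X \<and>
     (lunit X)\<inverse> O rel_prod \<eta> (Id_on X) O \<mu> = Id_on X \<and>
     (runit X)\<inverse> O rel_prod (Id_on X) \<eta> O \<mu> = Id_on X \<and>
     \<delta> O rel_prod \<epsilon> (Id_on X) O lunit X = Id_on X \<and>
     \<delta> O rel_prod (Id_on X) \<epsilon> O runit X = Id_on X \<and>
     rel_prod \<delta> (Id_on X) O assoc X O rel_prod (Id_on X) \<mu> = \<mu> O \<delta> \<and>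
     rel_prod (Id_on X) \<delta> O (assoc X)\<inverse> O rel_prod \<mu> (Id_on X) = \<mu> O \<delta>"

definition src :: "(unit \<times> 'a) set \<Rightarrow> (('a \<times> 'a) \<times> 'a) set \<Rightarrow> 'a \<Rightarrow> 'a" where
  "src \<eta> \<mu> x = (THE u. ((), u) \<in> \<eta> \<and> ((x, u), x) \<in> \<mu>)"

definition tgt :: "(unit \<times> 'a) set \<Rightarrow> (('a \<times> 'a) \<times> 'a) set \<Rightarrow> 'a \<Rightarrow> 'a" where
  "tgt \<eta> \<mu> x = (THE u. ((), u) \<in> \<eta> \<and> ((u, x), x) \<in> \<mu>)"

text \<open>The descriptions in \<open>src\<close> and \<open>tgt\<close> are proper on a Frobenius object.\<close>

context
  fixes X \<epsilon> \<eta> \<delta> \<mu>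
  assumes frob: "frobenius_object X \<epsilon> \<eta> \<delta> (\<mu> :: (('a \<times> 'a) \<times> 'a) set)"
begin

private lemma mu_carrier: "((x, y), z) \<in> \<mu> \<Longrightarrow> x \<in> X \<and> y \<in> X \<and> z \<in> X"
  using frob unfolding frobenius_object_def by (elim conjE) blast

private lemma delta_carrier: "(x, y, z) \<in> \<delta> \<Longrightarrow> x \<in> X \<and> y \<in> X \<and> z \<in> X"
  using frob unfolding frobenius_object_def by (elim conjE) blast

private lemma eta_carrier: "((), x) \<in> \<eta> \<Longrightarrow> x \<in> X"
  using frob unfolding frobenius_object_def by (elim conjE) blast

private lemma unit_left: "x \<in> X \<Longrightarrow> (\<exists>u. ((), u) \<in> \<eta> \<and> ((u, x), y) \<in> \<mu>) \<longleftrightarrow> x = y"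
proof -
  assume x: "x \<in> X"
  have "(lunit X)\<inverse> O rel_prod \<eta> (Id_on X) O \<mu> = Id_on X"
    using frob unfolding frobenius_object_def by (elim conjE)
  then have "(x, y) \<in> (lunit X)\<inverse> O rel_prod \<eta> (Id_on X) O \<mu> \<longleftrightarrow> (x, y) \<in> Id_on X" by simp
  then show ?thesis using x by (auto simp: lunit_def rel_prod_def relcomp_unfold)
qed

private lemma unit_right: "x \<in> X \<Longrightarrow> (\<exists>u. ((), u) \<in> \<eta> \<and> ((x, u), y) \<in> \<mu>) \<longleftrightarrow> x = y"
proof -
  assume x: "x \<in> X"
  have "(runit X)\<inverse> O rel_prod (Id_on X) \<eta> O \<mu> = Id_on X"
    using frob unfolding frobenius_object_def by (elim conjE)
  then have "(x, y) \<in> (runit X)\<inverse> O rel_prod (Id_on X) \<eta> O \<mu> \<longleftrightarrow> (x, y) \<in> Id_on X" by simp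
  then show ?thesis using x by (auto simp: runit_def rel_prod_def relcomp_unfold)
qed

private lemma counit_left: "x \<in> X \<Longrightarrow> (\<exists>e. (e, ()) \<in> \<epsilon> \<and> (x, e, y) \<in> \<delta>) \<longleftrightarrow> x = y"
proof -
  assume x: "x \<in> X"
  have "\<delta> O rel_prod \<epsilon> (Id_on X) O lunit X = Id_on X"
    using frob unfolding frobenius_object_def by (elim conjE)
  then have "(x, y) \<in> \<delta> O rel_prod \<epsilon> (Id_on X) O lunit X \<longleftrightarrow> (x, y) \<in> Id_on X" by simp
  then show ?thesis using x delta_carrier
    by (auto simp: lunit_def rel_prod_def relcomp_unfold) blast+
qed

private lemma counit_right: "x \<in> X \<Longrightarrow> (\<exists>e. (e, ()) \<in> \<epsilon> \<and> (x, y, e) \<in> \<delta>) \<longleftrightarrow> x = y"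
proof -
  assume x: "x \<in> X"
  have "\<delta> O rel_prod (Id_on X) \<epsilon> O runit X = Id_on X"
    using frob unfolding frobenius_object_def by (elim conjE)
  then have "(x, y) \<in> \<delta> O rel_prod (Id_on X) \<epsilon> O runit X \<longleftrightarrow> (x, y) \<in> Id_on X" by simp
  then show ?thesis using x delta_carrier
    by (auto simp: runit_def rel_prod_def relcomp_unfold) blast+
qed

private lemma frob_left:
  "(\<exists>w. (x, a, w) \<in> \<delta> \<and> ((w, y), b) \<in> \<mu>) \<longleftrightarrow> (\<exists>z. ((x, y), z) \<in> \<mu> \<and> (z, a, b) \<in> \<delta>)"
proof -
  have "rel_prod \<delta> (Id_on X) O assoc X O rel_prod (Id_on X) \<mu> = \<mu> O \<delta>"
    using frob unfolding frobenius_object_def by (elim conjE)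
  then have "((x, y), (a, b)) \<in> rel_prod \<delta> (Id_on X) O assoc X O rel_prod (Id_on X) \<mu>
    \<longleftrightarrow> ((x, y), (a, b)) \<in> \<mu> O \<delta>" by simp
  then show ?thesis using delta_carrier mu_carrier
    by (simp add: assoc_def rel_prod_def relcomp_unfold Id_on_iff) blast
qed

private lemma frob_right:
  "(\<exists>w. (y, w, b) \<in> \<delta> \<and> ((x, w), a) \<in> \<mu>) \<longleftrightarrow> (\<exists>z. ((x, y), z) \<in> \<mu> \<and> (z, a, b) \<in> \<delta>)"
proof -
  have "rel_prod (Id_on X) \<delta> O (assoc X)\<inverse> O rel_prod \<mu> (Id_on X) = \<mu> O \<delta>"
    using frob unfolding frobenius_object_def by (elim conjE)
  then have "((x, y), (a, b)) \<in> rel_prod (Id_on X) \<delta> O (assoc X)\<inverse> O rel_prod \<mu> (Id_on X)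
    \<longleftrightarrow> ((x, y), (a, b)) \<in> \<mu> O \<delta>" by simp
  then show ?thesis using delta_carrier mu_carrier
    by (simp add: assoc_def rel_prod_def relcomp_unfold Id_on_iff) blast
qed

lemma frobenius_assoc:
  "(\<exists>p. ((x, y), p) \<in> \<mu> \<and> ((p, z), q) \<in> \<mu>) \<longleftrightarrow> (\<exists>v. ((y, z), v) \<in> \<mu> \<and> ((x, v), q) \<in> \<mu>)"
proof
  assume "\<exists>p. ((x, y), p) \<in> \<mu> \<and> ((p, z), q) \<in> \<mu>"
  then obtain p where p: "((x, y), p) \<in> \<mu>" "((p, z), q) \<in> \<mu>" by blast
  obtain e where e: "(e, ()) \<in> \<epsilon>" "(q, q, e) \<in> \<delta>"
    using counit_right[of q q] mu_carrier[OF p(2)] by auto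
  obtain w where w: "(p, q, w) \<in> \<delta>" "((w, z), e) \<in> \<mu>"
    using frob_left[of p q z e] p(2) e(2) by auto
  obtain v where v: "(y, v, w) \<in> \<delta>" "((x, v), q) \<in> \<mu>"
    using frob_right[of y w x q] p(1) w(1) by auto
  obtain r where r: "((y, z), r) \<in> \<mu>" "(r, v, e) \<in> \<delta>"
    using frob_left[of y v z e] v(1) w(2) by auto
  have "r = v"
    using counit_right[of r v] e(1) r(2) delta_carrier[OF r(2)] by auto
  then show "\<exists>v. ((y, z), v) \<in> \<mu> \<and> ((x, v), q) \<in> \<mu>"
    using r(1) v(2) by auto
next
  assume "\<exists>v. ((y, z), v) \<in> \<mu> \<and> ((x, v), q) \<in> \<mu>"
  then obtain p where p: "((y, z), p) \<in> \<mu>" "((x, p), q) \<in> \<mu>" by blast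
  obtain e where e: "(e, ()) \<in> \<epsilon>" "(q, e, q) \<in> \<delta>"
    using counit_left[of q q] mu_carrier[OF p(2)] by auto
  obtain w where w: "(p, w, q) \<in> \<delta>" "((x, w), e) \<in> \<mu>"
    using frob_right[of p q x e] p(2) e(2) by auto
  obtain v where v: "(y, w, v) \<in> \<delta>" "((v, z), q) \<in> \<mu>"
    using frob_left[of y w z q] p(1) w(1) by auto
  obtain r where r: "((x, y), r) \<in> \<mu>" "(r, e, v) \<in> \<delta>"
    using frob_right[of y v x e] v(1) w(2) by auto
  have "r = v"
    using counit_left[of r v] e(1) r(2) delta_carrier[OF r(2)] by auto
  then show "\<exists>p. ((x, y), p) \<in> \<mu> \<and> ((p, z), q) \<in> \<mu>"
    using r(1) v(2) by auto
qed

lemma ex1_src: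
  assumes x: "x \<in> X"
  shows "\<exists>!u. ((), u) \<in> \<eta> \<and> ((x, u), x) \<in> \<mu>"
proof (rule ex_ex1I)
  show "\<exists>u. ((), u) \<in> \<eta> \<and> ((x, u), x) \<in> \<mu>"
    using unit_right[OF x, of x] by simp
next
  fix u v
  assume u: "((), u) \<in> \<eta> \<and> ((x, u), x) \<in> \<mu>" and v: "((), v) \<in> \<eta> \<and> ((x, v), x) \<in> \<mu>"
  then obtain w where "((u, v), w) \<in> \<mu>" using frobenius_assoc[of x u v x] by blast
  then show "u = v"
    using unit_left[of v w] unit_right[of u w] u v eta_carrier by blast
qed

lemma ex1_tgt:
  assumes x: "x \<in> X"
  shows "\<exists>!u. ((), u) \<in> \<eta> \<and> ((u, x), x) \<in> \<mu>"
proof (rule ex_ex1I)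
  show "\<exists>u. ((), u) \<in> \<eta> \<and> ((u, x), x) \<in> \<mu>"
    using unit_left[OF x, of x] by simp
next
  fix u v
  assume u: "((), u) \<in> \<eta> \<and> ((u, x), x) \<in> \<mu>" and v: "((), v) \<in> \<eta> \<and> ((v, x), x) \<in> \<mu>"
  then obtain w where "((u, v), w) \<in> \<mu>" using frobenius_assoc[of u v x x] by blast
  then show "u = v"
    using unit_left[of v w] unit_right[of u w] u v eta_carrier by blast
qed

end


section \<open>Simplicial sets\<close>

text \<open>
  All cells live in one type; \<open>face A q i\<close> and \<open>degen A q i\<close> are the maps out of \<open>cells A q\<close>, and
  their values outside \<open>cells A q\<close> are irrelevant.
\<close>

record 'c simplicial_data =
  cells :: "nat \<Rightarrow> 'c set"
  face :: "nat \<Rightarrow> nat \<Rightarrow> 'c \<Rightarrow> 'c"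
  degen :: "nat \<Rightarrow> nat \<Rightarrow> 'c \<Rightarrow> 'c"

text \<open>
  \<open>D\<close> is the set of available dimensions, \<open>UNIV\<close> or \<open>{..n}\<close>. An identity is required exactly when
  every map occurring in it is between available dimensions.
\<close>

definition simplicial_on :: "nat set \<Rightarrow> 'c simplicial_data \<Rightarrow> bool" where
  "simplicial_on D A \<longleftrightarrow>
     (\<forall>q i. 1 \<le> q \<and> q \<in> D \<and> i \<le> q \<longrightarrow> face A q i \<in> cells A q \<rightarrow> cells A (q - 1)) \<and>
     (\<forall>q i. q + 1 \<in> D \<and> i \<le> q \<longrightarrow> degen A q i \<in> cells A q \<rightarrow> cells A (q + 1)) \<and>
     (\<forall>q i j. 2 \<le> q \<and> q \<in> D \<and> i < j \<and> j \<le> q \<longrightarrow>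
        (\<forall>x \<in> cells A q. face A (q - 1) i (face A q j x) = face A (q - 1) (j - 1) (face A q i x))) \<and>
     (\<forall>q i j. q + 2 \<in> D \<and> i \<le> j \<and> j \<le> q \<longrightarrow>
        (\<forall>x \<in> cells A q. degen A (q + 1) i (degen A q j x) = degen A (q + 1) (j + 1) (degen A q i x))) \<and>
     (\<forall>q i j. q + 1 \<in> D \<and> i \<le> q + 1 \<and> j \<le> q \<longrightarrow>
        (\<forall>x \<in> cells A q. face A (q + 1) i (degen A q j x) =
           (if i < j then degen A (q - 1) (j - 1) (face A q i x)
            else if i = j \<or> i = j + 1 then x
            else degen A (q - 1) j (face A q (i - 1) x))))"

definition simplicial_set :: "'c simplicial_data \<Rightarrow> bool" where
  "simplicial_set A \<longleftrightarrow> simplicial_on UNIV A"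

definition truncated_simplicial_set :: "nat \<Rightarrow> 'c simplicial_data \<Rightarrow> bool" where
  "truncated_simplicial_set n A \<longleftrightarrow> simplicial_on {..n} A"

text \<open>The compatibility condition is void for \<open>q = 1\<close>, as there are no faces of \<open>0\<close>-cells.\<close>

definition matching_tuples :: "'c simplicial_data \<Rightarrow> nat \<Rightarrow> 'c list set" where
  "matching_tuples A q =
     {\<zeta>. length \<zeta> = q + 1 \<and> set \<zeta> \<subseteq> cells A (q - 1) \<and>
         (2 \<le> q \<longrightarrow> (\<forall>i j. i < j \<and> j \<le> q \<longrightarrow>
            face A (q - 1) i (\<zeta> ! j) = face A (q - 1) (j - 1) (\<zeta> ! i)))}"

definition boundary :: "'c simplicial_data \<Rightarrow> nat \<Rightarrow> 'c \<Rightarrow> 'c list" where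
  "boundary A q w = map (\<lambda>i. face A q i w) [0..<q + 1]"

definition coskeletal :: "nat \<Rightarrow> 'c simplicial_data \<Rightarrow> bool" where
  "coskeletal n A \<longleftrightarrow> (\<forall>q > n. bij_betw (boundary A q) (cells A q) (matching_tuples A q))"

definition simplicial_iso_on ::
  "nat set \<Rightarrow> (nat \<Rightarrow> 'b \<Rightarrow> 'c) \<Rightarrow> 'b simplicial_data \<Rightarrow> 'c simplicial_data \<Rightarrow> bool" where
  "simplicial_iso_on D f A B \<longleftrightarrow>
     (\<forall>q \<in> D. bij_betw (f q) (cells A q) (cells B q)) \<and>
     (\<forall>q i. 1 \<le> q \<and> q \<in> D \<and> i \<le> q \<longrightarrow>
        (\<forall>x \<in> cells A q. f (q - 1) (face A q i x) = face B q i (f q x))) \<and>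
     (\<forall>q i. q + 1 \<in> D \<and> i \<le> q \<longrightarrow>
        (\<forall>x \<in> cells A q. f (q + 1) (degen A q i x) = degen B q i (f q x)))"

text \<open>
  \<open>A\<close> together with an identification \<open>\<iota>\<close> of \<open>T\<close> with the \<open>n\<close>-truncation of \<open>A\<close>. For
  \<open>\<iota> = (\<lambda>q. id)\<close> this says that \<open>A\<close> literally agrees with \<open>T\<close> in dimensions up to \<open>n\<close>.
\<close>

definition coskeletal_extension ::
  "nat \<Rightarrow> 'b simplicial_data \<Rightarrow> 'c simplicial_data \<Rightarrow> (nat \<Rightarrow> 'b \<Rightarrow> 'c) \<Rightarrow> bool" where
  "coskeletal_extension n T A \<iota> \<longleftrightarrow>
     simplicial_set A \<and> coskeletal n A \<and> simplicial_iso_on {..n} \<iota> T A"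


section \<open>The truncated simplicial set of a Frobenius object\<close>

text \<open>
  \<open>Elt\<close> and \<open>Triple\<close> hold the elements of \<open>X\<close> and of its cube; \<open>Tuple\<close> leaves room for the higher
  cells of an extension, which may be taken to be tuples of cells one dimension lower.
\<close>

datatype 'a cell = Elt 'a | Triple 'a 'a 'a | Tuple "'a cell list"

definition frobenius_cells ::
  "'a set \<Rightarrow> (unit \<times> 'a) set \<Rightarrow> (('a \<times> 'a) \<times> 'a) set \<Rightarrow> nat \<Rightarrow> 'a cell set" where
  "frobenius_cells X \<eta> \<mu> q =
     (if q = 0 then {Elt u | u. ((), u) \<in> \<eta>}
      else if q = 1 then {Elt x | x. x \<in> X}
      else if q = 2 then {Triple x y z | x y z. ((x, y), z) \<in> \<mu>}
      else {})"

fun frobenius_face ::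
  "(unit \<times> 'a) set \<Rightarrow> (('a \<times> 'a) \<times> 'a) set \<Rightarrow> nat \<Rightarrow> nat \<Rightarrow> 'a cell \<Rightarrow> 'a cell" where
  "frobenius_face \<eta> \<mu> q i (Elt x) = Elt (if i = 0 then src \<eta> \<mu> x else tgt \<eta> \<mu> x)"
| "frobenius_face \<eta> \<mu> q i (Triple x y z) = Elt (if i = 0 then y else if i = 1 then z else x)"
| "frobenius_face \<eta> \<mu> q i (Tuple cs) = undefined"

fun frobenius_degen ::
  "(unit \<times> 'a) set \<Rightarrow> (('a \<times> 'a) \<times> 'a) set \<Rightarrow> nat \<Rightarrow> nat \<Rightarrow> 'a cell \<Rightarrow> 'a cell" where
  "frobenius_degen \<eta> \<mu> q i (Elt x) =
     (if q = 0 then Elt x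
      else if i = 0 then Triple (tgt \<eta> \<mu> x) x x
      else Triple x (src \<eta> \<mu> x) x)"
| "frobenius_degen \<eta> \<mu> q i (Triple x y z) = undefined"
| "frobenius_degen \<eta> \<mu> q i (Tuple cs) = undefined"

definition frobenius_simplicial ::
  "'a set \<Rightarrow> (unit \<times> 'a) set \<Rightarrow> (('a \<times> 'a) \<times> 'a) set \<Rightarrow> 'a cell simplicial_data" where
  "frobenius_simplicial X \<eta> \<mu> =
     \<lparr>cells = frobenius_cells X \<eta> \<mu>, face = frobenius_face \<eta> \<mu>, degen = frobenius_degen \<eta> \<mu>\<rparr>"

end

theory Submission
  imports Defs
begin

text \<open>
  Associativity turns \<open>s\<close> and \<open>t\<close> into the source and target of a category-like structure:
  \<open>(x, y, z) \<in> \<mu>\<close> forces \<open>s x = t y\<close>, \<open>s z = s y\<close> and \<open>t z = t x\<close>, which are exactly the face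
  identities in dimension \<open>2\<close>; those involving degeneracies only use the unit laws.
  Any \<open>n\<close>-truncated simplicial set extends to a coskeletal one: above dimension \<open>n\<close> a cell is its
  boundary tuple, so the degeneracies are forced by the identities for \<open>d\<^sub>i s\<^sub>j\<close>, and every remaining
  identity, as well as the uniqueness of the extension, is checked on boundaries by induction on
  the dimension.
\<close>

section \<open>Frobenius objects\<close>

context
  fixes X :: "'a set" and \<epsilon> \<eta> \<delta> \<mu>
  assumes frob: "frobenius_object X \<epsilon> \<eta> \<delta> \<mu>"
begin

lemma frobenius_mu_carrier: "((x, y), z) \<in> \<mu> \<Longrightarrow> x \<in> X \<and> y \<in> X \<and> z \<in> X"
  using frob unfolding frobenius_object_def by (elim conjE) blast

lemma frobenius_eta_carrier: "((), u) \<in> \<eta> \<Longrightarrow> u \<in> X"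
  using frob unfolding frobenius_object_def by (elim conjE) blast

lemma frobenius_unit_left:
  assumes u: "((), u) \<in> \<eta>" and m: "((u, x), y) \<in> \<mu>"
  shows "x = y"
proof -
  have "(lunit X)\<inverse> O rel_prod \<eta> (Id_on X) O \<mu> = Id_on X"
    using frob unfolding frobenius_object_def by (elim conjE)
  moreover have "(x, y) \<in> (lunit X)\<inverse> O rel_prod \<eta> (Id_on X) O \<mu>"
    using u m frobenius_mu_carrier[OF m] by (auto simp: lunit_def rel_prod_def relcomp_unfold)
  ultimately show ?thesis by auto
qed

lemma frobenius_unit_right:
  assumes u: "((), u) \<in> \<eta>" and m: "((x, u), y) \<in> \<mu>"
  shows "x = y"
proof -
  have "(runit X)\<inverse> O rel_prod (Id_on X) \<eta> O \<mu> = Id_on X"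
    using frob unfolding frobenius_object_def by (elim conjE)
  moreover have "(x, y) \<in> (runit X)\<inverse> O rel_prod (Id_on X) \<eta> O \<mu>"
    using u m frobenius_mu_carrier[OF m] by (auto simp: runit_def rel_prod_def relcomp_unfold)
  ultimately show ?thesis by auto
qed

section \<open>Source and target of elements, units and products\<close>

lemma src_mem: "x \<in> X \<Longrightarrow> ((), src \<eta> \<mu> x) \<in> \<eta> \<and> ((x, src \<eta> \<mu> x), x) \<in> \<mu>"
  using theI'[OF ex1_src[OF frob]] unfolding src_def .

lemma tgt_mem: "x \<in> X \<Longrightarrow> ((), tgt \<eta> \<mu> x) \<in> \<eta> \<and> ((tgt \<eta> \<mu> x, x), x) \<in> \<mu>"
  using theI'[OF ex1_tgt[OF frob]] unfolding tgt_def .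

lemma src_eqI: "((), u) \<in> \<eta> \<Longrightarrow> ((x, u), x) \<in> \<mu> \<Longrightarrow> src \<eta> \<mu> x = u"
  unfolding src_def by (rule the1_equality[OF ex1_src[OF frob]]) (auto dest: frobenius_mu_carrier)

lemma tgt_eqI: "((), u) \<in> \<eta> \<Longrightarrow> ((u, x), x) \<in> \<mu> \<Longrightarrow> tgt \<eta> \<mu> x = u"
  unfolding tgt_def by (rule the1_equality[OF ex1_tgt[OF frob]]) (auto dest: frobenius_mu_carrier)

text \<open>The triple \<open>((u, src \<eta> \<mu> u), u)\<close> lies in \<open>\<mu>\<close>, and
  its first entry is a unit, so the left unit law identifies the other two.\<close>

lemma src_unit: "((), u) \<in> \<eta> \<Longrightarrow> src \<eta> \<mu> u = u"
  using src_mem[OF frobenius_eta_carrier] frobenius_unit_left by blast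

lemma tgt_unit: "((), u) \<in> \<eta> \<Longrightarrow> tgt \<eta> \<mu> u = u"
  using tgt_mem[OF frobenius_eta_carrier] frobenius_unit_right by blast

text \<open>Replace \<open>x\<close> by its product with \<open>src \<eta> \<mu> x\<close> and
  reassociate: the source of \<open>x\<close> becomes composable with \<open>y\<close>. Being a
  unit, it can only return \<open>y\<close>, so it is the target of \<open>y\<close>.\<close>

lemma mu_src_eq_tgt:
  assumes m: "((x, y), z) \<in> \<mu>"
  shows "src \<eta> \<mu> x = tgt \<eta> \<mu> y"
proof -
  have x: "((), src \<eta> \<mu> x) \<in> \<eta>" "((x, src \<eta> \<mu> x), x) \<in> \<mu>"
    using src_mem frobenius_mu_carrier[OF m] by auto
  obtain v where "((src \<eta> \<mu> x, y), v) \<in> \<mu>"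
    using frobenius_assoc[OF frob, of x "src \<eta> \<mu> x" y z] x m by auto
  then show ?thesis using frobenius_unit_left x(1) tgt_eqI by metis
qed

text \<open>Replace \<open>y\<close> by its product with its source and reassociate:
  \<open>z\<close> becomes the product of some \<open>p\<close> with that unit. The unit law gives
  \<open>p = z\<close>, so the unit is also the source of \<open>z\<close>.\<close>

lemma mu_src:
  assumes m: "((x, y), z) \<in> \<mu>"
  shows "src \<eta> \<mu> z = src \<eta> \<mu> y"
proof -
  have y: "((), src \<eta> \<mu> y) \<in> \<eta>" "((y, src \<eta> \<mu> y), y) \<in> \<mu>"
    using src_mem frobenius_mu_carrier[OF m] by auto
  obtain p where "((p, src \<eta> \<mu> y), z) \<in> \<mu>"
    using frobenius_assoc[OF frob, of x y "src \<eta> \<mu> y" z] y m by auto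
  then show ?thesis using frobenius_unit_right y(1) src_eqI by metis
qed

lemma mu_tgt:
  assumes m: "((x, y), z) \<in> \<mu>"
  shows "tgt \<eta> \<mu> z = tgt \<eta> \<mu> x"
proof -
  have x: "((), tgt \<eta> \<mu> x) \<in> \<eta>" "((tgt \<eta> \<mu> x, x), x) \<in> \<mu>"
    using tgt_mem frobenius_mu_carrier[OF m] by auto
  obtain p where "((tgt \<eta> \<mu> x, p), z) \<in> \<mu>"
    using frobenius_assoc[OF frob, of "tgt \<eta> \<mu> x" x y z] x m by auto
  then show ?thesis using frobenius_unit_left x(1) tgt_eqI by metis
qed

section \<open>The simplicial identities up to dimension 2\<close>

lemma truncated_frobenius_simplicial:
  "truncated_simplicial_set 2 (frobenius_simplicial X \<eta> \<mu>)"
proof -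
  let ?A = "frobenius_simplicial X \<eta> \<mu>"
  have c: "cells ?A 0 = {Elt u | u. ((), u) \<in> \<eta>}" "cells ?A 1 = {Elt x | x. x \<in> X}"
      "cells ?A (Suc 0) = {Elt x | x. x \<in> X}"
      "cells ?A 2 = {Triple x y z | x y z. ((x, y), z) \<in> \<mu>}"
      "cells ?A (Suc (Suc 0)) = {Triple x y z | x y z. ((x, y), z) \<in> \<mu>}"
    by (simp_all add: frobenius_simplicial_def frobenius_cells_def)
  have fd: "face ?A = frobenius_face \<eta> \<mu>" "degen ?A = frobenius_degen \<eta> \<mu>"
    by (simp_all add: frobenius_simplicial_def)
  have face: "face ?A q i \<in> cells ?A q \<rightarrow> cells ?A (q - 1)" if "1 \<le> q" "q \<le> 2" for q i
  proof -
    have "q = 1 \<or> q = 2" using that by auto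
    then show ?thesis
      using src_mem tgt_mem frobenius_mu_carrier by (auto simp: c fd)
  qed
  have degen: "degen ?A q i \<in> cells ?A q \<rightarrow> cells ?A (q + 1)" if "q + 1 \<le> 2" for q i
  proof -
    have "q = 0 \<or> q = 1" using that by auto
    then show ?thesis
    proof
      assume "q = 0"
      then show ?thesis using frobenius_eta_carrier by (auto simp: c fd)
    next
      assume "q = 1"
      then show ?thesis using src_mem tgt_mem by (auto simp: c fd)
    qed
  qed
  have ff: "face ?A (q - 1) i (face ?A q j x) = face ?A (q - 1) (j - 1) (face ?A q i x)"
    if q: "2 \<le> q" "q \<le> 2" "i < j" "j \<le> q" "x \<in> cells ?A q" for q i j x
  proof -
    have "q = 2" and ij: "i = 0 \<and> j = 1 \<or> i = 0 \<and> j = 2 \<or> i = 1 \<and> j = 2"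
      using q by auto
    then obtain a b e where x: "x = Triple a b e" and m: "((a, b), e) \<in> \<mu>"
      using q by (auto simp: c)
    \<comment> \<open>For the index pairs (0,1), (0,2), (1,2) the identity says in turn:
      \<open>e\<close> and \<open>b\<close> have the same source; the source of \<open>a\<close> is
      the target of \<open>b\<close>; \<open>a\<close> and \<open>e\<close> have the same
      target.\<close>
    show ?thesis using ij mu_src[OF m] mu_tgt[OF m] mu_src_eq_tgt[OF m]
      by (auto simp: x fd)
  qed
  have dd: "degen ?A (q + 1) i (degen ?A q j x) = degen ?A (q + 1) (j + 1) (degen ?A q i x)"
    if "q + 2 \<le> 2" "i \<le> j" "j \<le> q" "x \<in> cells ?A q" for q i j x
  proof -
    have "q = 0" "i = 0" "j = 0" using that by auto
    \<comment> \<open>A unit is its own source and target, so both sides are the triple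
      \<open>(u, u, u)\<close>.\<close>
    then show ?thesis using that(4) by (auto simp: c fd src_unit tgt_unit)
  qed
  have fdeg: "face ?A (q + 1) i (degen ?A q j x) =
           (if i < j then degen ?A (q - 1) (j - 1) (face ?A q i x)
            else if i = j \<or> i = j + 1 then x
            else degen ?A (q - 1) j (face ?A q (i - 1) x))"
    if "q + 1 \<le> 2" "i \<le> q + 1" "j \<le> q" "x \<in> cells ?A q" for q i j x
  proof -
    have "q = 0 \<or> q = 1" using that by auto
    then show ?thesis
    proof
      assume q: "q = 0"
      then have "j = 0" "i = 0 \<or> i = 1" using that by auto
      then show ?thesis using that(4) q by (auto simp: c fd src_unit tgt_unit)
    next
      assume q: "q = 1"
      then have "j = 0 \<or> j = 1" "i = 0 \<or> i = 1 \<or> i = 2" using that by auto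
      then show ?thesis using that(4) q by (auto simp: c fd)
    qed
  qed
  show ?thesis unfolding truncated_simplicial_set_def simplicial_on_def atMost_iff
    by (intro conjI allI impI ballI) (elim conjE, (rule face degen ff dd fdeg; assumption))+
qed

end


section \<open>Coskeletal extensions\<close>

lemma boundary_eq_iff:
  "boundary A q x = boundary B q y \<longleftrightarrow> (\<forall>i\<le>q. face A q i x = face B q i y)"
  by (auto simp: boundary_def)

lemma length_boundary [simp]: "length (boundary A q x) = q + 1"
  by (simp add: boundary_def)

lemma nth_boundary [simp]: "i \<le> q \<Longrightarrow> boundary A q x ! i = face A q i x"
  unfolding boundary_def by (simp del: upt_Suc)

text \<open>This is the injectivity half of coskeletality. It reduces the identities between
  degeneracies, and the comparison of maps into a coskeletal set, to faces.\<close>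

lemma coskeletal_cell_eqI:
  assumes "coskeletal n A" "q > n" "x \<in> cells A q" "y \<in> cells A q"
    and "\<And>i. i \<le> q \<Longrightarrow> face A q i x = face A q i y"
  shows "x = y"
proof (rule inj_onD)
  show "inj_on (boundary A q) (cells A q)"
    using assms(1,2) by (simp add: coskeletal_def bij_betw_def)
  show "boundary A q x = boundary A q y"
    using assms(5) by (simp add: boundary_eq_iff)
qed fact+

text \<open>The value that the simplicial identities prescribe for the \<open>i\<close>-th face of
  the \<open>j\<close>-th degeneracy of \<open>x\<close>. It serves both as a specification and as
  the recipe for constructing degeneracies. For \<open>q = 0\<close>, \<open>j = 0\<close> and
  \<open>i \<le> 1\<close> only the middle branch occurs, so the truncated subtraction does no
  harm.\<close>

definition degen_face :: "'c simplicial_data \<Rightarrow> nat \<Rightarrow> nat \<Rightarrow> 'c \<Rightarrow> nat \<Rightarrow> 'c" where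
  "degen_face A q j x i =
     (if i < j then degen A (q - 1) (j - 1) (face A q i x)
      else if i = j \<or> i = j + 1 then x
      else degen A (q - 1) j (face A q (i - 1) x))"

lemma simplicial_on_iff:
  "simplicial_on D A \<longleftrightarrow>
     (\<forall>q i x. 1 \<le> q \<and> q \<in> D \<and> i \<le> q \<and> x \<in> cells A q \<longrightarrow> face A q i x \<in> cells A (q - 1)) \<and>
     (\<forall>q i x. q + 1 \<in> D \<and> i \<le> q \<and> x \<in> cells A q \<longrightarrow> degen A q i x \<in> cells A (q + 1)) \<and>
     (\<forall>q i j x. 2 \<le> q \<and> q \<in> D \<and> i < j \<and> j \<le> q \<and> x \<in> cells A q \<longrightarrow>
        face A (q - 1) i (face A q j x) = face A (q - 1) (j - 1) (face A q i x)) \<and>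
     (\<forall>q i j x. q + 2 \<in> D \<and> i \<le> j \<and> j \<le> q \<and> x \<in> cells A q \<longrightarrow>
        degen A (q + 1) i (degen A q j x) = degen A (q + 1) (j + 1) (degen A q i x)) \<and>
     (\<forall>q i j x. q + 1 \<in> D \<and> i \<le> q + 1 \<and> j \<le> q \<and> x \<in> cells A q \<longrightarrow>
        face A (q + 1) i (degen A q j x) = degen_face A q j x i)"
  unfolding simplicial_on_def degen_face_def Pi_iff Ball_def
  by (simp only: imp_conjL all_simps)

text \<open>The prescribed faces of a degeneracy fit together, so a coskeletal set has a cell with
  this boundary. The hypotheses concern dimensions up to \<open>q\<close> and degeneracies out of
  dimension \<open>q - 1\<close>, which is what an induction on \<open>q\<close> can supply.\<close>

lemma degen_face_matching:
  assumes face: "\<And>i x. 1 \<le> q \<Longrightarrow> i \<le> q \<Longrightarrow> x \<in> cells A q \<Longrightarrow> face A q i x \<in> cells A (q - 1)"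
    and ff: "\<And>i j x. 2 \<le> q \<Longrightarrow> i < j \<Longrightarrow> j \<le> q \<Longrightarrow> x \<in> cells A q \<Longrightarrow>
      face A (q - 1) i (face A q j x) = face A (q - 1) (j - 1) (face A q i x)"
    and degen: "\<And>i x. 1 \<le> q \<Longrightarrow> i \<le> q - 1 \<Longrightarrow> x \<in> cells A (q - 1) \<Longrightarrow>
      degen A (q - 1) i x \<in> cells A q"
    and fdeg: "\<And>i j x. 1 \<le> q \<Longrightarrow> i \<le> q \<Longrightarrow> j \<le> q - 1 \<Longrightarrow> x \<in> cells A (q - 1) \<Longrightarrow>
      face A q i (degen A (q - 1) j x) = degen_face A (q - 1) j x i"
    and j: "j \<le> q" and x: "x \<in> cells A q"
  shows "map (degen_face A q j x) [0..<q + 2] \<in> matching_tuples A (q + 1)"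
proof -
  have mem: "degen_face A q j x k \<in> cells A q" if "k \<le> q + 1" for k
  proof -
    have "degen A (q - 1) l (face A q m x) \<in> cells A q" if "1 \<le> q" "l \<le> q - 1" "m \<le> q" for l m
      using that x by (intro degen face)
    then show ?thesis using that j x by (auto simp: degen_face_def)
  qed
  have match: "face A q i (degen_face A q j x k) = face A q (k - 1) (degen_face A q j x i)"
    if q: "1 \<le> q" and ik: "i < k" and k: "k \<le> q + 1" for i k
  proof -
    have s: "face A q i (degen A (q - 1) l (face A q m x)) = degen_face A (q - 1) l (face A q m x) i"
      if "i \<le> q" "l \<le> q - 1" "m \<le> q" for i l m
      using that q x by (intro fdeg face)
    \<comment> \<open>If \<open>i\<close> or \<open>k\<close> is \<open>j\<close> or
      \<open>j + 1\<close>, a face cancels the degeneracy. Otherwise (cases 1, 4 and 8) two faces of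
      \<open>x\<close> must commute; an index beyond \<open>j + 1\<close> enters \<open>ff\<close>
      lowered by one.\<close>
    consider "k < j" | "i < j" "k = j" | "i < j" "k = j + 1" | "i < j" "k > j + 1"
      | "i = j" "k = j + 1" | "i = j" "k > j + 1" | "i = j + 1" "k > j + 1" | "i > j + 1"
      using ik by linarith
    then show ?thesis
    proof cases
      case 1
      then show ?thesis using ik j k x ff[of i k x]
        by (auto simp: degen_face_def s simp del: One_nat_def)
    next
      case 4
      then show ?thesis using ik j k x ff[of i "k - 1" x]
        by (auto simp: degen_face_def s simp del: One_nat_def)
    next
      case 8
      then show ?thesis using ik j k x ff[of "i - 1" "k - 1" x]
        by (auto simp: degen_face_def s simp del: One_nat_def)
    qed (use ik j k x in \<open>auto simp: degen_face_def s simp del: One_nat_def\<close>)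
  qed
  show ?thesis
    unfolding matching_tuples_def
  proof (intro CollectI conjI impI allI; (elim conjE)?)
    show "set (map (degen_face A q j x) [0..<q + 2]) \<subseteq> cells A (q + 1 - 1)"
      using mem by (auto simp del: upt_Suc)
    show "face A (q + 1 - 1) i (map (degen_face A q j x) [0..<q + 2] ! k) =
        face A (q + 1 - 1) (k - 1) (map (degen_face A q j x) [0..<q + 2] ! i)"
      if "2 \<le> q + 1" "i < k" "k \<le> q + 1" for i k
      using match[of i k] that by (simp del: upt_Suc)
  qed simp
qed

text \<open>Both sides have dimension \<open>q + 2 > n\<close>, so it suffices to compare faces.
  Pushing a face through both degeneracies leaves at most the same identity one dimension lower,
  which is \<open>dd\<close>.\<close>

lemma degen_degen_step:
  assumes cosk: "coskeletal n A" and q: "q + 2 > n"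
    and face: "\<And>i x. 1 \<le> q \<Longrightarrow> i \<le> q \<Longrightarrow> x \<in> cells A q \<Longrightarrow> face A q i x \<in> cells A (q - 1)"
    and degen: "\<And>p i x. i \<le> p \<Longrightarrow> x \<in> cells A p \<Longrightarrow> degen A p i x \<in> cells A (p + 1)"
    and fdeg: "\<And>p i j x. i \<le> p + 1 \<Longrightarrow> j \<le> p \<Longrightarrow> x \<in> cells A p \<Longrightarrow>
      face A (p + 1) i (degen A p j x) = degen_face A p j x i"
    and dd: "\<And>i j x. 1 \<le> q \<Longrightarrow> i \<le> j \<Longrightarrow> j \<le> q - 1 \<Longrightarrow> x \<in> cells A (q - 1) \<Longrightarrow>
      degen A q i (degen A (q - 1) j x) = degen A q (j + 1) (degen A (q - 1) i x)"
    and ij: "i \<le> j" "j \<le> q" and x: "x \<in> cells A q"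
  shows "degen A (q + 1) i (degen A q j x) = degen A (q + 1) (j + 1) (degen A q i x)"
proof (rule coskeletal_cell_eqI[OF cosk q])
  show "degen A (q + 1) i (degen A q j x) \<in> cells A (q + 2)"
       "degen A (q + 1) (j + 1) (degen A q i x) \<in> cells A (q + 2)"
    using degen[of _ "q + 1"] degen[of _ q] ij x by simp_all
next
  fix k assume k: "k \<le> q + 2"
  have f2: "face A (q + 2) k (degen A (q + 1) l (degen A q m x)) =
      degen_face A (q + 1) l (degen A q m x) k" if "l \<le> q + 1" "m \<le> q" for l m
    using fdeg[of k "q + 1" l "degen A q m x"] degen[of m q x] k x that by simp
  have f1: "face A (Suc q) k (degen A q l x) = degen_face A q l x k" if "k \<le> q + 1" "l \<le> q" for k l
    using fdeg[of k q l x] x that by simp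
  have L: "face A (q + 2) k (degen A (q + 1) i (degen A q j x)) =
      degen_face A (q + 1) i (degen A q j x) k"
    and R: "face A (q + 2) k (degen A (q + 1) (j + 1) (degen A q i x)) =
      degen_face A (q + 1) (j + 1) (degen A q i x) k"
    using ij by (simp_all only: f2)
  \<comment> \<open>Only in cases 1, 5 and 8 does the face survive both degeneracies; it then
    reaches \<open>x\<close> with index \<open>k\<close>, \<open>k - 1\<close> or
    \<open>k - 2\<close>. In the other cases it cancels one of them.\<close>
  consider "k < i" | "k = i" | "k = i + 1" "i < j" | "k = i + 1" "i = j"
    | "i + 1 < k" "k < j + 1" | "i + 1 < k" "k = j + 1" | "k = j + 2" | "k > j + 2"
    using ij by linarith
  then have "degen_face A (q + 1) i (degen A q j x) k = degen_face A (q + 1) (j + 1) (degen A q i x) k"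
  proof cases
    case 1
    then show ?thesis
      using ij k x dd[of "i - 1" "j - 1" "face A q k x"] face[of k x]
      by (auto simp: degen_face_def f1)
  next
    case 5
    then show ?thesis
      using ij k x dd[of i "j - 1" "face A q (k - 1) x"] face[of "k - 1" x]
      by (auto simp: degen_face_def f1)
  next
    case 8
    then show ?thesis
      using ij k x dd[of i j "face A q (k - 2) x"] face[of "k - 2" x]
      by (auto simp: degen_face_def f1 numeral_2_eq_2)
  qed (use ij k x in \<open>auto simp: degen_face_def f1\<close>)
  then show "face A (q + 2) k (degen A (q + 1) i (degen A q j x)) =
    face A (q + 2) k (degen A (q + 1) (j + 1) (degen A q i x))"
    unfolding L R .
qed

text \<open>
  The map \<open>tup\<close> encodes tuples of cells as cells of the same type. It need not avoid the cells
  of \<open>T\<close>, since every operation knows the dimension in which it acts.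
\<close>

definition coskel_face ::
  "('c list \<Rightarrow> 'c) \<Rightarrow> nat \<Rightarrow> 'c simplicial_data \<Rightarrow> nat \<Rightarrow> nat \<Rightarrow> 'c \<Rightarrow> 'c" where
  "coskel_face tup n T q i c = (if q \<le> n then face T q i c else inv tup c ! i)"

text \<open>Matching tuples refer to cells only one dimension lower. The constant family with the
  previous stage as value therefore keeps the recursion primitive.\<close>

primrec coskel_cells ::
  "('c list \<Rightarrow> 'c) \<Rightarrow> nat \<Rightarrow> 'c simplicial_data \<Rightarrow> nat \<Rightarrow> 'c set" where
  "coskel_cells tup n T 0 = cells T 0"
| "coskel_cells tup n T (Suc q) =
     (if Suc q \<le> n then cells T (Suc q)
      else tup ` matching_tuples
        \<lparr>cells = (\<lambda>_. coskel_cells tup n T q), face = coskel_face tup n T, degen = degen T\<rparr> (Suc q))"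

text \<open>The bound is strict because a degeneracy out of dimension \<open>q\<close> is given by
  \<open>T\<close> only if \<open>q + 1 \<le> n\<close>. As \<open>degen_face\<close> calls
  degeneracies just one dimension lower, a constant family suffices here too. The pair
  \<open>[c, c]\<close> consists of the two faces of a degenerate 1-cell.\<close>

primrec coskel_degen ::
  "('c list \<Rightarrow> 'c) \<Rightarrow> nat \<Rightarrow> 'c simplicial_data \<Rightarrow> nat \<Rightarrow> nat \<Rightarrow> 'c \<Rightarrow> 'c" where
  "coskel_degen tup n T 0 j c = (if 0 < n then degen T 0 j c else tup [c, c])"
| "coskel_degen tup n T (Suc q) j c =
     (if Suc q < n then degen T (Suc q) j c
      else tup (map (degen_face
        \<lparr>cells = cells T, face = coskel_face tup n T, degen = (\<lambda>_. coskel_degen tup n T q)\<rparr>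
        (Suc q) j c) [0..<Suc q + 2]))"

definition coskeleton :: "('c list \<Rightarrow> 'c) \<Rightarrow> nat \<Rightarrow> 'c simplicial_data \<Rightarrow> 'c simplicial_data" where
  "coskeleton tup n T =
     \<lparr>cells = coskel_cells tup n T, face = coskel_face tup n T, degen = coskel_degen tup n T\<rparr>"

section \<open>The recursive coskeleton and its simplicial identities\<close>

lemma matching_tuples_cong:
  "cells A (q - 1) = cells B (q - 1) \<Longrightarrow> face A (q - 1) = face B (q - 1) \<Longrightarrow>
    matching_tuples A q = matching_tuples B q"
  by (simp add: matching_tuples_def)

lemma coskeleton_low:
  "q \<le> n \<Longrightarrow> cells (coskeleton tup n T) q = cells T q"
  "q \<le> n \<Longrightarrow> face (coskeleton tup n T) q = face T q"
  "q < n \<Longrightarrow> degen (coskeleton tup n T) q = degen T q"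
  by (cases q; force simp: coskeleton_def coskel_face_def)+

lemma cells_coskeleton_high:
  assumes "n < q"
  shows "cells (coskeleton tup n T) q = tup ` matching_tuples (coskeleton tup n T) q"
proof -
  obtain p where p: "q = Suc p" using assms by (cases q) auto
  have "cells (coskeleton tup n T) q = tup ` matching_tuples
      \<lparr>cells = (\<lambda>_. coskel_cells tup n T p), face = coskel_face tup n T, degen = degen T\<rparr> q"
    using assms by (simp add: coskeleton_def p)
  also have "\<dots> = tup ` matching_tuples (coskeleton tup n T) q"
    by (intro arg_cong[where f = "image tup"] matching_tuples_cong) (simp_all add: coskeleton_def p)
  finally show ?thesis .
qed

lemma face_coskeleton_high:
  "inj tup \<Longrightarrow> n < q \<Longrightarrow> face (coskeleton tup n T) q i (tup \<zeta>) = \<zeta> ! i"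
  by (simp add: coskeleton_def coskel_face_def)

lemma degen_coskeleton_high:
  assumes "n \<le> q" "j \<le> q"
  shows "degen (coskeleton tup n T) q j c =
    tup (map (degen_face (coskeleton tup n T) q j c) [0..<q + 2])"
proof (cases q)
  case 0
  then show ?thesis using assms by (simp add: coskeleton_def degen_face_def)
next
  case (Suc p)
  have "degen_face
      \<lparr>cells = cells T, face = coskel_face tup n T, degen = (\<lambda>_. coskel_degen tup n T p)\<rparr> (Suc p) j c =
      degen_face (coskeleton tup n T) (Suc p) j c"
    by (rule ext) (simp add: degen_face_def coskeleton_def)
  then show ?thesis using assms Suc by (simp add: coskeleton_def del: upt_Suc)
qed

lemma boundary_coskeleton:
  assumes "inj tup" "n < q" "\<zeta> \<in> matching_tuples (coskeleton tup n T) q"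
  shows "boundary (coskeleton tup n T) q (tup \<zeta>) = \<zeta>"
  using assms
  by (intro nth_equalityI) (auto simp: matching_tuples_def face_coskeleton_high less_Suc_eq_le)

lemma coskeletal_coskeleton:
  assumes "inj tup"
  shows "coskeletal n (coskeleton tup n T)"
  unfolding coskeletal_def
proof (intro allI impI)
  fix q assume q: "n < q"
  show "bij_betw (boundary (coskeleton tup n T) q) (cells (coskeleton tup n T) q)
      (matching_tuples (coskeleton tup n T) q)"
    unfolding cells_coskeleton_high[OF q]
    \<comment> \<open>The encoding \<open>tup\<close> itself is the inverse of the boundary
      map.\<close>
    by (rule bij_betw_byWitness[where f' = tup]) (auto simp: boundary_coskeleton[OF assms q])
qed

lemma simplicial_set_coskeleton:
  assumes T: "truncated_simplicial_set n T" and inj: "inj tup"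
  shows "simplicial_set (coskeleton tup n T)"
proof -
  let ?A = "coskeleton tup n T"
  note T' = T[unfolded truncated_simplicial_set_def simplicial_on_iff atMost_iff]
  have cosk: "coskeletal n ?A" by (rule coskeletal_coskeleton[OF inj])
  \<comment> \<open>Above dimension \<open>n\<close>, membership and commutation of faces are read
    off from the boundary being a matching tuple.\<close>
  have bd: "boundary ?A q x \<in> matching_tuples ?A q" if "n < q" "x \<in> cells ?A q" for q x
    using cosk that unfolding coskeletal_def bij_betw_def by blast
  have face: "face ?A q i x \<in> cells ?A (q - 1)" if "1 \<le> q" "i \<le> q" "x \<in> cells ?A q" for q i x
  proof (cases "q \<le> n")
    case True
    then show ?thesis using that T' by (simp add: coskeleton_low)
  next
    case False
    then have "set (boundary ?A q x) \<subseteq> cells ?A (q - 1)"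
      using bd that by (auto simp: matching_tuples_def)
    moreover have "boundary ?A q x ! i \<in> set (boundary ?A q x)"
      using that by (intro nth_mem) simp
    ultimately show ?thesis using that by auto
  qed
  have ff: "face ?A (q - 1) i (face ?A q j x) = face ?A (q - 1) (j - 1) (face ?A q i x)"
    if "2 \<le> q" "i < j" "j \<le> q" "x \<in> cells ?A q" for q i j x
  proof (cases "q \<le> n")
    case True
    then show ?thesis using that T' by (simp add: coskeleton_low)
  next
    case False
    then have "face ?A (q - 1) i (boundary ?A q x ! j) = face ?A (q - 1) (j - 1) (boundary ?A q x ! i)"
      using bd[of q x] that by (simp add: matching_tuples_def del: One_nat_def)
    then show ?thesis using that by simp
  qed
  \<comment> \<open>Membership and face identities are proved together: the prescribed tuple in
    dimension \<open>q + 1\<close> is matching only if both hold for degeneracies out of dimension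
    \<open>q - 1\<close>.\<close>
  have deg: "(\<forall>j\<le>q. \<forall>x \<in> cells ?A q. degen ?A q j x \<in> cells ?A (q + 1) \<and>
      (\<forall>i\<le>q + 1. face ?A (q + 1) i (degen ?A q j x) = degen_face ?A q j x i))" for q
  proof (induction q rule: less_induct)
    case (less q)
    show ?case
    proof (intro allI impI ballI)
      fix j x assume j: "j \<le> q" and x: "x \<in> cells ?A q"
      show "degen ?A q j x \<in> cells ?A (q + 1) \<and>
        (\<forall>i\<le>q + 1. face ?A (q + 1) i (degen ?A q j x) = degen_face ?A q j x i)"
      proof (cases "q < n")
        case True
        then have "degen_face ?A q j x i = degen_face T q j x i" for i
          by (simp add: degen_face_def coskeleton_low)
        then show ?thesis using True T' j x by (simp add: coskeleton_low)
      next
        case False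
        have IH: "degen ?A (q - 1) i y \<in> cells ?A q"
          "k \<le> q \<Longrightarrow> face ?A q k (degen ?A (q - 1) i y) = degen_face ?A (q - 1) i y k"
          if "1 \<le> q" "i \<le> q - 1" "y \<in> cells ?A (q - 1)" for i y k
          using less[of "q - 1"] that by auto
        have M: "map (degen_face ?A q j x) [0..<q + 2] \<in> matching_tuples ?A (q + 1)"
          using face[of q] ff[of q] IH j x by (intro degen_face_matching) auto
        then have "degen ?A q j x \<in> cells ?A (q + 1)"
          using False j by (simp add: cells_coskeleton_high degen_coskeleton_high)
        moreover have "face ?A (q + 1) i (degen ?A q j x) = degen_face ?A q j x i"
          if "i \<le> q + 1" for i
          using that False j
          by (simp add: degen_coskeleton_high face_coskeleton_high[OF inj] del: upt_Suc)
        ultimately show ?thesis by blast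
      qed
    qed
  qed
  have dd: "\<forall>i j. \<forall>x \<in> cells ?A q. i \<le> j \<and> j \<le> q \<longrightarrow>
      degen ?A (q + 1) i (degen ?A q j x) = degen ?A (q + 1) (j + 1) (degen ?A q i x)" for q
  proof (induction q rule: less_induct)
    case (less q)
    show ?case
    \<comment> \<open>The identity takes its values in dimension \<open>q + 2\<close>, so the
      comparison of faces already applies when that exceeds \<open>n\<close>, even if
      \<open>q \<le> n\<close>.\<close>
    proof (cases "q + 2 \<le> n")
      case True
      then show ?thesis using T' by (simp add: coskeleton_low)
    next
      case False
      have IH: "degen ?A q i (degen ?A (q - 1) j x) = degen ?A q (j + 1) (degen ?A (q - 1) i x)"
        if "1 \<le> q" "i \<le> j" "j \<le> q - 1" "x \<in> cells ?A (q - 1)" for i j x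
        using less[of "q - 1"] that by auto
      show ?thesis
      proof (intro allI ballI impI; elim conjE)
        fix i j x assume "x \<in> cells ?A q" "i \<le> j" "j \<le> q"
        then show "degen ?A (q + 1) i (degen ?A q j x) = degen ?A (q + 1) (j + 1) (degen ?A q i x)"
          using False deg IH face[of q]
          by (intro degen_degen_step[OF cosk]) auto
      qed
    qed
  qed
  show ?thesis unfolding simplicial_set_def simplicial_on_iff
    using face ff deg dd by simp
qed

lemma coskeletal_extension_coskeleton:
  assumes "truncated_simplicial_set n T" "inj tup"
  shows "coskeletal_extension n T (coskeleton tup n T) (\<lambda>q. id)"
  using simplicial_set_coskeleton[OF assms] coskeletal_coskeleton[OF assms(2)]
  by (simp add: coskeletal_extension_def simplicial_iso_on_def coskeleton_low)


section \<open>Uniqueness of coskeletal extensions\<close>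

lemma simplicial_iso_on_inv:
  assumes A: "simplicial_on {..n} A" and f: "simplicial_iso_on {..n} f A B"
  shows "simplicial_iso_on {..n} (\<lambda>q. inv_into (cells A q) (f q)) B A"
proof -
  let ?g = "\<lambda>q. inv_into (cells A q) (f q)"
  have bij: "bij_betw (f q) (cells A q) (cells B q)" if "q \<le> n" for q
    using f that by (simp add: simplicial_iso_on_def)
  have gf: "?g q (f q x) = x" if "q \<le> n" "x \<in> cells A q" for q x
    using bij_betw_inv_into_left[OF bij] that by blast
  have ex: "\<exists>x \<in> cells A q. y = f q x" if "q \<le> n" "y \<in> cells B q" for q y
    using bij[OF that(1)] that(2) by (auto simp: bij_betw_def)
  have "?g (q - 1) (face B q i y) = face A q i (?g q y)"
    if q: "1 \<le> q" "q \<le> n" "i \<le> q" "y \<in> cells B q" for q i y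
  proof -
    obtain x where x: "x \<in> cells A q" "y = f q x" using ex[of q y] q by blast
    have "face B q i y = f (q - 1) (face A q i x)"
      using f q x by (simp add: simplicial_iso_on_def)
    \<comment> \<open>\<open>inv_into\<close> cancels \<open>f\<close> only on cells, so closure of
      \<open>A\<close> under faces is required.\<close>
    moreover have "face A q i x \<in> cells A (q - 1)"
      using A q x by (simp add: simplicial_on_iff)
    ultimately show ?thesis using gf q x by simp
  qed
  moreover have "?g (q + 1) (degen B q i y) = degen A q i (?g q y)"
    if q: "q + 1 \<le> n" "i \<le> q" "y \<in> cells B q" for q i y
  proof -
    obtain x where x: "x \<in> cells A q" "y = f q x" using ex[of q y] q by auto
    have "degen B q i y = f (q + 1) (degen A q i x)"
      using f q x by (simp add: simplicial_iso_on_def)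
    moreover have "degen A q i x \<in> cells A (q + 1)"
      using A q x by (simp add: simplicial_on_iff)
    ultimately show ?thesis using gf q x by simp
  qed
  ultimately show ?thesis
    unfolding simplicial_iso_on_def using bij_betw_inv_into[OF bij] by auto
qed

lemma simplicial_iso_on_comp:
  assumes f: "simplicial_iso_on {..n} f A B" and g: "simplicial_iso_on {..n} g B C"
  shows "simplicial_iso_on {..n} (\<lambda>q. g q \<circ> f q) A C"
proof -
  have "bij_betw (f q) (cells A q) (cells B q)" "bij_betw (g q) (cells B q) (cells C q)"
    if "q \<le> n" for q
    using f g that by (simp_all add: simplicial_iso_on_def)
  moreover have "f q x \<in> cells B q" if "q \<le> n" "x \<in> cells A q" for q x
    using calculation(1) that bij_betwE by blast
  ultimately show ?thesis
    using f g unfolding simplicial_iso_on_def by (auto intro: bij_betw_trans)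
qed

text \<open>Here \<open>f\<close> acts in dimension \<open>q - 1\<close> and \<open>g\<close> in
  dimension \<open>q - 2\<close>. Commuting with faces transports compatibility, and injectivity of
  \<open>g\<close> reflects it. The guards \<open>2 \<le> q\<close> leave \<open>q = 1\<close>
  without conditions, where compatibility is void.\<close>

lemma matching_tuples_bij:
  assumes A: "\<And>i x. 2 \<le> q \<Longrightarrow> i \<le> q - 1 \<Longrightarrow> x \<in> cells A (q - 1) \<Longrightarrow>
      face A (q - 1) i x \<in> cells A (q - 2)"
    and f: "bij_betw f (cells A (q - 1)) (cells B (q - 1))"
    and g: "2 \<le> q \<Longrightarrow> inj_on g (cells A (q - 2))"
    and gf: "\<And>i x. 2 \<le> q \<Longrightarrow> i \<le> q - 1 \<Longrightarrow> x \<in> cells A (q - 1) \<Longrightarrow>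
      g (face A (q - 1) i x) = face B (q - 1) i (f x)"
  shows "bij_betw (map f) (matching_tuples A q) (matching_tuples B q)"
proof -
  have iff: "map f \<zeta> \<in> matching_tuples B q \<longleftrightarrow> \<zeta> \<in> matching_tuples A q"
    if \<zeta>: "set \<zeta> \<subseteq> cells A (q - 1)" for \<zeta>
  proof -
    have "(face B (q - 1) i (map f \<zeta> ! j) = face B (q - 1) (j - 1) (map f \<zeta> ! i)) \<longleftrightarrow>
        (face A (q - 1) i (\<zeta> ! j) = face A (q - 1) (j - 1) (\<zeta> ! i))"
      if "2 \<le> q" "i < j" "j \<le> q" "length \<zeta> = q + 1" for i j
    proof -
      have m: "\<zeta> ! i \<in> cells A (q - 1)" "\<zeta> ! j \<in> cells A (q - 1)"
        using \<zeta> that by (auto intro: subsetD)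
      have "face B (q - 1) i (map f \<zeta> ! j) = g (face A (q - 1) i (\<zeta> ! j))"
        "face B (q - 1) (j - 1) (map f \<zeta> ! i) = g (face A (q - 1) (j - 1) (\<zeta> ! i))"
        using m gf that by simp_all
      moreover have "face A (q - 1) i (\<zeta> ! j) \<in> cells A (q - 2)"
        "face A (q - 1) (j - 1) (\<zeta> ! i) \<in> cells A (q - 2)"
        using A m that by simp_all
      ultimately show ?thesis using g[OF that(1)] by (simp add: inj_on_eq_iff)
    qed
    moreover have "set (map f \<zeta>) \<subseteq> cells B (q - 1)"
      using \<zeta> f by (auto simp: bij_betw_def)
    ultimately show ?thesis using \<zeta> unfolding matching_tuples_def by auto
  qed
  have sub: "set \<zeta> \<subseteq> cells A (q - 1)" if "\<zeta> \<in> matching_tuples A q" for \<zeta>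
    using that by (simp add: matching_tuples_def)
  have "inj_on (map f) (matching_tuples A q)"
  proof (rule inj_onI)
    fix \<zeta> \<xi> assume "\<zeta> \<in> matching_tuples A q" "\<xi> \<in> matching_tuples A q" "map f \<zeta> = map f \<xi>"
    then show "\<zeta> = \<xi>"
      using sub f by (intro map_inj_on[of f]) (auto simp: bij_betw_def intro: inj_on_subset)
  qed
  moreover have "map f ` matching_tuples A q = matching_tuples B q"
  proof (intro equalityI subsetI)
    fix \<xi> assume "\<xi> \<in> map f ` matching_tuples A q"
    then show "\<xi> \<in> matching_tuples B q" using iff sub by blast
  next
    fix \<xi> assume \<xi>: "\<xi> \<in> matching_tuples B q"
    then have "\<xi> \<in> lists (f ` cells A (q - 1))"
      using f by (auto simp: matching_tuples_def bij_betw_def)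
    then obtain \<zeta> where "\<xi> = map f \<zeta>" "set \<zeta> \<subseteq> cells A (q - 1)"
      by (auto simp: lists_image)
    then show "\<xi> \<in> map f ` matching_tuples A q" using \<xi> iff by blast
  qed
  ultimately show ?thesis by (simp add: bij_betw_def)
qed

text \<open>Above \<open>n\<close> a cell goes to the unique filler of the entrywise image of its
  boundary. Restriction to cells makes uniqueness an equality of functions.\<close>

primrec coskeletal_map ::
  "nat \<Rightarrow> 'b simplicial_data \<Rightarrow> 'c simplicial_data \<Rightarrow> (nat \<Rightarrow> 'b \<Rightarrow> 'c) \<Rightarrow> nat \<Rightarrow> 'b \<Rightarrow> 'c" where
  "coskeletal_map n A B g 0 = restrict (g 0) (cells A 0)"
| "coskeletal_map n A B g (Suc q) =
     restrict (if Suc q \<le> n then g (Suc q)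
       else (\<lambda>x. inv_into (cells B (Suc q)) (boundary B (Suc q))
         (map (coskeletal_map n A B g q) (boundary A (Suc q) x)))) (cells A (Suc q))"

lemma coskeletal_map_low: "q \<le> n \<Longrightarrow> coskeletal_map n A B g q = restrict (g q) (cells A q)"
  by (cases q) simp_all

lemma coskeletal_map_extensional: "coskeletal_map n A B g q \<in> extensional (cells A q)"
  by (cases q) (simp_all add: restrict_extensional)

text \<open>Above \<open>n\<close> the map is a composite of bijections: boundary in
  \<open>A\<close>, entrywise image, inverse boundary in \<open>B\<close>. Faces commute by
  construction, and degeneracies follow by comparing faces in \<open>B\<close>.\<close>

lemma simplicial_iso_coskeletal_map:
  assumes A: "simplicial_set A" "coskeletal n A" and B: "simplicial_set B" "coskeletal n B"
    and g: "simplicial_iso_on {..n} g A B"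
  shows "simplicial_iso_on UNIV (coskeletal_map n A B g) A B"
proof -
  let ?f = "coskeletal_map n A B g"
  note A' = A(1)[unfolded simplicial_set_def simplicial_on_iff, simplified]
  note B' = B(1)[unfolded simplicial_set_def simplicial_on_iff, simplified]
  note g' = g[unfolded simplicial_iso_on_def, simplified]
  have faceA: "face A q i x \<in> cells A (q - 1)" if "1 \<le> q" "i \<le> q" "x \<in> cells A q" for q i x
    using A' that by simp
  \<comment> \<open>The bijection on matching tuples uses both bijectivity and commutation with
    faces in lower dimensions, hence the joint induction.\<close>
  have main: "bij_betw (?f q) (cells A q) (cells B q) \<and>
      (1 \<le> q \<longrightarrow> (\<forall>i\<le>q. \<forall>x \<in> cells A q. ?f (q - 1) (face A q i x) = face B q i (?f q x)))" for q
  proof (induction q rule: less_induct)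
    case (less q)
    show ?case
    proof (cases "q \<le> n")
      case True
      then show ?thesis using g' faceA
        by (auto simp: coskeletal_map_low cong: bij_betw_cong)
    next
      case False
      then obtain p where p: "q = Suc p" by (cases q) auto
      have bijA: "bij_betw (boundary A q) (cells A q) (matching_tuples A q)"
        and bijB: "bij_betw (boundary B q) (cells B q) (matching_tuples B q)"
        using A(2) B(2) False by (simp_all add: coskeletal_def)
      have bijM: "bij_betw (map (?f (q - 1))) (matching_tuples A q) (matching_tuples B q)"
      proof (rule matching_tuples_bij[where g = "?f (q - 2)"])
        show "bij_betw (?f (q - 1)) (cells A (q - 1)) (cells B (q - 1))"
          using less[of "q - 1"] p by simp
        show "face A (q - 1) i x \<in> cells A (q - 2)"
          if "2 \<le> q" "i \<le> q - 1" "x \<in> cells A (q - 1)" for i x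
          using faceA[of "q - 1" i x] that by (simp add: numeral_2_eq_2)
        show "inj_on (?f (q - 2)) (cells A (q - 2))" if "2 \<le> q"
          using less[of "q - 2"] that by (simp add: bij_betw_def)
        show "?f (q - 2) (face A (q - 1) i x) = face B (q - 1) i (?f (q - 1) x)"
          if "2 \<le> q" "i \<le> q - 1" "x \<in> cells A (q - 1)" for i x
          using less[of "q - 1"] that by (simp add: numeral_2_eq_2)
      qed
      let ?h = "inv_into (cells B q) (boundary B q) \<circ> (map (?f (q - 1)) \<circ> boundary A q)"
      have "bij_betw ?h (cells A q) (cells B q)"
        using bijA bijM bij_betw_inv_into[OF bijB] by (blast intro: bij_betw_trans)
      moreover have fh: "?f q x = ?h x" if "x \<in> cells A q" for x
        using that False p by simp
      ultimately have "bij_betw (?f q) (cells A q) (cells B q)"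
        by (simp cong: bij_betw_cong)
      moreover have "?f (q - 1) (face A q i x) = face B q i (?f q x)"
        if i: "i \<le> q" and x: "x \<in> cells A q" for i x
      proof -
        have "map (?f (q - 1)) (boundary A q x) \<in> matching_tuples B q"
          using bijA bijM x by (auto simp: bij_betw_def)
        then have "boundary B q (?f q x) = map (?f (q - 1)) (boundary A q x)"
          using bijB fh[OF x] by (simp add: bij_betw_inv_into_right)
        then have "boundary B q (?f q x) ! i = map (?f (q - 1)) (boundary A q x) ! i" by simp
        then show ?thesis using i by simp
      qed
      ultimately show ?thesis by blast
    qed
  qed
  have fB: "?f q x \<in> cells B q" if "x \<in> cells A q" for q x
    using main[of q] that bij_betwE by blast
  have fface: "?f q (face A (q + 1) i x) = face B (q + 1) i (?f (q + 1) x)"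
    if "i \<le> q + 1" "x \<in> cells A (q + 1)" for q i x
    using main[of "q + 1"] that by simp
  have fdegen: "\<forall>i\<le>q. \<forall>x \<in> cells A q. ?f (q + 1) (degen A q i x) = degen B q i (?f q x)" for q
  proof (induction q rule: less_induct)
    case (less q)
    show ?case
    proof (intro allI impI ballI)
      fix j x assume j: "j \<le> q" and x: "x \<in> cells A q"
      have dA: "degen A q j x \<in> cells A (q + 1)" using A' j x by simp
      have dB: "degen B q j (?f q x) \<in> cells B (q + 1)" using B' j fB[OF x] by simp
      show "?f (q + 1) (degen A q j x) = degen B q j (?f q x)"
      proof (cases "q + 1 \<le> n")
        case True
        then show ?thesis using g' j x dA by (simp add: coskeletal_map_low)
      next
        case False
        show ?thesis
        proof (rule coskeletal_cell_eqI[OF B(2)])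
          fix i assume i: "i \<le> q + 1"
          have "face B (q + 1) i (?f (q + 1) (degen A q j x)) = ?f q (degen_face A q j x i)"
            using fface[OF i dA] A' i j x by simp
          also have "\<dots> = degen_face B q j (?f q x) i"
          proof -
            have IH: "?f q (degen A (q - 1) l (face A q m x)) = degen B (q - 1) l (face B q m (?f q x))"
              if "1 \<le> q" "l \<le> q - 1" "m \<le> q" for l m
              using less[of "q - 1"] main[of q] faceA[of q m x] that x by simp
            show ?thesis using i j by (auto simp: degen_face_def IH simp del: One_nat_def)
          qed
          also have "\<dots> = face B (q + 1) i (degen B q j (?f q x))"
            using B' i j fB[OF x] by simp
          finally show "face B (q + 1) i (?f (q + 1) (degen A q j x)) =
            face B (q + 1) i (degen B q j (?f q x))" .
        qed (use False fB[OF dA] dB in auto)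
      qed
    qed
  qed
  show ?thesis unfolding simplicial_iso_on_def using main fdegen by auto
qed

text \<open>The faces of \<open>f q x\<close> are the images of the faces of \<open>x\<close>, so by
  induction \<open>f q x\<close> and \<open>h q x\<close> have equal boundaries.\<close>

lemma simplicial_iso_coskeletal_unique:
  assumes A: "simplicial_set A" and B: "coskeletal n B"
    and f: "simplicial_iso_on UNIV f A B" and h: "simplicial_iso_on UNIV h A B"
    and low: "\<And>q x. q \<le> n \<Longrightarrow> x \<in> cells A q \<Longrightarrow> f q x = h q x"
    and x: "x \<in> cells A q"
  shows "f q x = h q x"
  using x
proof (induction q arbitrary: x rule: less_induct)
  case (less q)
  show ?case
  proof (cases "q \<le> n")
    case True
    then show ?thesis using low less.prems by simp
  next
    case False
    show ?thesis
    proof (rule coskeletal_cell_eqI[OF B])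
      show "n < q" using False by simp
      show "f q x \<in> cells B q" "h q x \<in> cells B q"
        using f h less.prems by (auto simp: simplicial_iso_on_def intro: bij_betw_apply)
      fix i assume i: "i \<le> q"
      have "face A q i x \<in> cells A (q - 1)"
        using A False i less.prems by (simp add: simplicial_set_def simplicial_on_iff)
      then have "f (q - 1) (face A q i x) = h (q - 1) (face A q i x)"
        using False less.IH by simp
      then show "face B q i (f q x) = face B q i (h q x)"
        using f h False i less.prems by (simp add: simplicial_iso_on_def)
    qed
  qed
qed

lemma coskeletal_extension_unique:
  assumes T: "truncated_simplicial_set n T"
    and A: "coskeletal_extension n T A \<iota>" and B: "coskeletal_extension n T B \<kappa>"
  shows "\<exists>!f. (\<forall>q. f q \<in> extensional (cells A q)) \<and> simplicial_iso_on UNIV f A B \<and>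
    (\<forall>q\<le>n. \<forall>x \<in> cells T q. f q (\<iota> q x) = \<kappa> q x)"
proof -
  note A' = A[unfolded coskeletal_extension_def] and B' = B[unfolded coskeletal_extension_def]
  have bij: "bij_betw (\<iota> q) (cells T q) (cells A q)" if "q \<le> n" for q
    using A' that by (simp add: simplicial_iso_on_def)
  \<comment> \<open>The only map of truncations compatible with both identifications of
    \<open>T\<close>.\<close>
  define g where "g = (\<lambda>q. \<kappa> q \<circ> inv_into (cells T q) (\<iota> q))"
  have "simplicial_iso_on {..n} g A B"
    unfolding g_def using A' B' T unfolding truncated_simplicial_set_def
    by (intro simplicial_iso_on_comp[of _ _ A T] simplicial_iso_on_inv) auto
  then have iso: "simplicial_iso_on UNIV (coskeletal_map n A B g) A B"
    using A' B' by (blast intro: simplicial_iso_coskeletal_map)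
  have low: "coskeletal_map n A B g q (\<iota> q x) = \<kappa> q x" if "q \<le> n" "x \<in> cells T q" for q x
    using bij_betw_inv_into_left[OF bij] bij_betwE[OF bij] that
    by (simp add: coskeletal_map_low g_def)
  show ?thesis
  proof (rule ex1I[of _ "coskeletal_map n A B g"], intro conjI allI impI ballI)
    fix f assume f: "(\<forall>q. f q \<in> extensional (cells A q)) \<and> simplicial_iso_on UNIV f A B \<and>
      (\<forall>q\<le>n. \<forall>x \<in> cells T q. f q (\<iota> q x) = \<kappa> q x)"
    \<comment> \<open>Every cell of \<open>A\<close> up to dimension \<open>n\<close> is some
      \<open>\<iota> q x\<close>, so the condition on \<open>\<iota>\<close> and
      \<open>\<kappa>\<close> fixes \<open>f\<close> there.\<close>
    have eq: "f q y = coskeletal_map n A B g q y" if q: "q \<le> n" "y \<in> cells A q" for q y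
    proof -
      obtain x where "x \<in> cells T q" "y = \<iota> q x"
        using bij[OF q(1)] q(2) by (auto simp: bij_betw_def)
      then show ?thesis using f low q by simp
    qed
    have "f q x = coskeletal_map n A B g q x" if "x \<in> cells A q" for q x
      using A' B' f by (intro simplicial_iso_coskeletal_unique[OF _ _ _ iso eq that]) auto
    then have "f q = coskeletal_map n A B g q" for q
      using f by (intro extensionalityI[OF _ coskeletal_map_extensional]) auto
    then show "f = coskeletal_map n A B g" by (rule ext)
  qed (use iso low coskeletal_map_extensional in auto)
qed

theorem theorem5p1:
  fixes X :: "'a set"
    and \<epsilon> :: "('a \<times> unit) set"
    and \<eta> :: "(unit \<times> 'a) set"
    and \<delta> :: "('a \<times> ('a \<times> 'a)) set"
    and \<mu> :: "(('a \<times> 'a) \<times> 'a) set"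
  assumes "frobenius_object X \<epsilon> \<eta> \<delta> \<mu>"
  shows "truncated_simplicial_set 2 (frobenius_simplicial X \<eta> \<mu>)
    \<and> (\<exists>A :: 'a cell simplicial_data.
          coskeletal_extension 2 (frobenius_simplicial X \<eta> \<mu>) A (\<lambda>q. id))
    \<and> (\<forall>(A :: 'b simplicial_data) (B :: 'c simplicial_data) \<iota> \<kappa>.
          coskeletal_extension 2 (frobenius_simplicial X \<eta> \<mu>) A \<iota> \<and>
          coskeletal_extension 2 (frobenius_simplicial X \<eta> \<mu>) B \<kappa> \<longrightarrow>
          (\<exists>!f. (\<forall>q. f q \<in> extensional (cells A q)) \<and>
                simplicial_iso_on UNIV f A B \<and>
                (\<forall>q \<le> 2. \<forall>x \<in> cells (frobenius_simplicial X \<eta> \<mu>) q. f q (\<iota> q x) = \<kappa> q x)))"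
proof -
  have T: "truncated_simplicial_set 2 (frobenius_simplicial X \<eta> \<mu>)"
    by (rule truncated_frobenius_simplicial[OF assms])
  \<comment> \<open>\<open>Tuple\<close> encodes lists of cells as cells of the same type, as the
    coskeleton requires.\<close>
  have "inj (Tuple :: 'a cell list \<Rightarrow> 'a cell)" by (simp add: inj_def)
  from coskeletal_extension_coskeleton[OF T this]
  have "\<exists>A :: 'a cell simplicial_data.
      coskeletal_extension 2 (frobenius_simplicial X \<eta> \<mu>) A (\<lambda>q. id)" ..
  with T coskeletal_extension_unique[OF T] show ?thesis by blast
qed

end
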